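(* Let $n\geq 2$ and $v\geq 2$, and let $G$ be a maximal weakly $(n,v)$-clique-partitioned graph. Then $G$ is isomorphic to the graph $\Gamma'(n,v)$.
   Context: A $v$-clique is a set of $v$ pairwise adjacent vertices. A graph of order $nv$ is weakly $(n,v)$-clique-partitioned if its vertex set can be decomposed in a unique way into $n$ vertex-disjoint $v$-cliques. Every weakly $(n,v)$-clique-partitioned graph has at most $\binom{nv}{2}-\frac{n(n-1)v}{2}$ edges; one is called maximal if it has exactly this many edges. The graph $\Gamma'(n,v)$ has vertex set $\{(i,j):0\leq i\leq n-1,\ 0\leq j\leq v-1\}$ and is obtained from the complete graph on this vertex set by removing all edges joining $(i,0)$ to $(k,\ell)$ for all $0\leq i\leq n-2$, $i<k\leq n-1$, $0\leq \ell\leq v-1$. *)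

theory Defs
  imports Main "HOL-Library.Ramsey" "HOL-Library.Disjoint_Sets"
begin

text \<open>A graph is given by a vertex set \<open>V\<close> and a set \<open>E\<close> of edges, each a two-element subset
  of \<open>V\<close>. Cliques are those of the Ramsey library: \<open>clique C E\<close> says that
  the elements of \<open>C\<close> are pairwise adjacent with respect to \<open>E\<close>.\<close>

definition simple_graph :: "'a set \<Rightarrow> 'a set set \<Rightarrow> bool" where
  "simple_graph V E \<longleftrightarrow> finite V \<and> E \<subseteq> [V]\<^bsup>2\<^esup>"

definition graph_isomorphic :: "'a set \<Rightarrow> 'a set set \<Rightarrow> 'b set \<Rightarrow> 'b set set \<Rightarrow> bool" where
  "graph_isomorphic V E V' E' \<longleftrightarrow>
     (\<exists>f. bij_betw f V V' \<and> (\<forall>x\<in>V. \<forall>y\<in>V. {x, y} \<in> E \<longleftrightarrow> {f x, f y} \<in> E'))"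

definition clique_partition :: "nat \<Rightarrow> nat \<Rightarrow> 'a set \<Rightarrow> 'a set set \<Rightarrow> 'a set set \<Rightarrow> bool" where
  "clique_partition n v V E P \<longleftrightarrow>
     partition_on V P \<and> card P = n \<and> (\<forall>C\<in>P. card C = v \<and> clique C E)"

definition weakly_clique_partitioned :: "nat \<Rightarrow> nat \<Rightarrow> 'a set \<Rightarrow> 'a set set \<Rightarrow> bool" where
  "weakly_clique_partitioned n v V E \<longleftrightarrow>
     simple_graph V E \<and> card V = n * v \<and> (\<exists>!P. clique_partition n v V E P)"

text \<open>In the next definition the division by 2 is exact, and since
  \<open>n * (n - 1) * v div 2 \<le> (n * v) choose 2\<close> the outer subtraction does not truncate.\<close>

definition maximal_weakly_clique_partitioned :: "nat \<Rightarrow> nat \<Rightarrow> 'a set \<Rightarrow> 'a set set \<Rightarrow> bool" where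
  "maximal_weakly_clique_partitioned n v V E \<longleftrightarrow>
     weakly_clique_partitioned n v V E \<and>
     card E = ((n * v) choose 2) - n * (n - 1) * v div 2"

definition Gamma'_verts :: "nat \<Rightarrow> nat \<Rightarrow> (nat \<times> nat) set" where
  "Gamma'_verts n v = {0..<n} \<times> {0..<v}"

text \<open>The range \<open>0 \<le> i \<le> n - 2\<close> of the first index is implied by \<open>i < k\<close> and \<open>k < n\<close>.\<close>

definition Gamma'_edges :: "nat \<Rightarrow> nat \<Rightarrow> (nat \<times> nat) set set" where
  "Gamma'_edges n v =
     [Gamma'_verts n v]\<^bsup>2\<^esup> - {{(i, 0), (k, l)} | i k l. i < k \<and> k < n \<and> l < v}"

end

(* Between two blocks A and B of the partition at least v edges are missing: if A and B both had a
   vertex joined to the whole other block, these two could be exchanged. Hence, say, every vertex of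
   B misses some vertex of A. If only v edges are missing, each b in B misses exactly one vertex
   phi(b) of A; exchanging the set T of vertices of B with a common value a of phi against a and
   |T| - 1 vertices of A outside the range of phi shows T = B, so all missing edges join B to one
   vertex a of A, the apex. The edge count forces this for every pair of blocks, which gives a
   tournament on the blocks. Rotating one vertex of each of three blocks excludes cyclic triangles
   and blocks with two different apexes, so the tournament is a linear order and every block has
   one apex; its apex becomes the vertex (i,0) of the target graph. *)

theory Submission
  imports Defs "HOL-Combinatorics.Transposition"
begin

section \<open>Exchanges in a unique partition into cliques\<close>

locale unique_clique_partition =
  fixes n v :: nat and V :: "'a set" and E :: "'a set set" and P :: "'a set set"
  assumes graph: "simple_graph V E"
    and v_ge_2: "2 \<le> v"
    and clique_partition: "clique_partition n v V E P"
    and unique: "clique_partition n v V E P' \<Longrightarrow> P' = P"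
begin

lemma finite_V: "finite V"
  using graph by (simp add: simple_graph_def)

lemma partition: "partition_on V P"
  using clique_partition by (simp add: clique_partition_def)

lemma finite_P: "finite P"
  using finite_elements[OF finite_V partition] .

lemma card_P: "card P = n"
  using clique_partition by (simp add: clique_partition_def)

lemma block_subset: "A \<in> P \<Longrightarrow> A \<subseteq> V"
  using partition by (auto simp: partition_on_def)

lemma finite_block: "A \<in> P \<Longrightarrow> finite A"
  using block_subset finite_V finite_subset by blast

lemma card_block: "A \<in> P \<Longrightarrow> card A = v"
  using clique_partition by (simp add: clique_partition_def)

lemma block_adjacent: "A \<in> P \<Longrightarrow> x \<in> A \<Longrightarrow> y \<in> A \<Longrightarrow> x \<noteq> y \<Longrightarrow> {x, y} \<in> E"
  using clique_partition by (auto simp: clique_partition_def clique_def)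

lemma block_eqI: "A \<in> P \<Longrightarrow> B \<in> P \<Longrightarrow> x \<in> A \<Longrightarrow> x \<in> B \<Longrightarrow> A = B"
  using partition by (auto simp: partition_on_def disjoint_def)

lemma other_element:
  assumes "A \<in> P"
  obtains y where "y \<in> A" "y \<noteq> x"
proof -
  have "\<not> A \<subseteq> {x}"
    using card_mono[of "{x}" A] card_block[OF assms] v_ge_2 by auto
  then show thesis using that by blast
qed

lemma not_loop: "{x} \<notin> E"
  using graph by (auto simp: simple_graph_def nsets_def)

text \<open>Replacing the blocks \<open>Q\<close> by \<open>Q'\<close> gives a clique partition of
  the whole graph again, so uniqueness identifies it with \<open>P\<close>. Every later exchange is
  refuted by exhibiting a new block that cannot belong to \<open>P\<close>.\<close>

lemma exchange:
  assumes "Q \<subseteq> P" "partition_on (\<Union>Q) Q'" "card Q' = card Q"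
    and "\<And>C. C \<in> Q' \<Longrightarrow> card C = v \<and> clique C E"
  shows "Q' \<subseteq> P"
proof -
  have Un: "V = \<Union>(P - Q) \<union> \<Union>Q"
    using partition assms(1) by (auto simp: partition_on_def)
  have disj: "disjnt (\<Union>(P - Q)) (\<Union>Q)"
    using block_eqI assms(1) by (fastforce simp: disjnt_def)
  have part: "partition_on V (P - Q \<union> Q')"
    unfolding partition_on_def
  proof (intro conjI)
    show "\<Union>(P - Q \<union> Q') = V" using Un partition_onD1[OF assms(2)] by auto
    have "disjoint (P - Q)"
      using partition_onD2[OF partition] by (rule pairwise_subset) auto
    then show "disjoint (P - Q \<union> Q')"
      using partition_onD2[OF assms(2)] disj partition_onD1[OF assms(2)]
      by (intro disjoint_union) (auto simp: disjnt_def)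
    show "{} \<notin> P - Q \<union> Q'"
      using partition_onD3[OF partition] partition_onD3[OF assms(2)] by auto
  qed
  have fin: "finite Q" "finite Q'"
    using assms(1,2) finite_P finite_subset finite_elements
      finite_subset[OF _ finite_V, of "\<Union>Q"] Un by blast+
  \<comment> \<open>The number of blocks stays \<open>n\<close> only if no new block coincides with
    a retained one. A common block would be nonempty and lie in two disjoint unions.\<close>
  have "(P - Q) \<inter> Q' = {}"
  proof (rule ccontr)
    assume "(P - Q) \<inter> Q' \<noteq> {}"
    then obtain C where C: "C \<in> P - Q" "C \<in> Q'" by blast
    then obtain x where "x \<in> C" using partition_onD3[OF assms(2)] by fastforce
    then have "x \<in> \<Union>(P - Q)" "x \<in> \<Union>Q" using C partition_onD1[OF assms(2)] by blast+
    then show False using disj by (auto simp: disjnt_def)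
  qed
  then have "card (P - Q \<union> Q') = card (P - Q) + card Q'"
    using fin finite_P by (intro card_Un_disjoint) auto
  also have "\<dots> = n"
    using assms(1,3) fin finite_P card_P card_mono[OF finite_P assms(1)]
    by (simp add: card_Diff_subset)
  finally have "clique_partition n v V E (P - Q \<union> Q')"
    using part assms(4) clique_partition by (auto simp: clique_partition_def)
  then show ?thesis using unique by blast
qed

text \<open>The two adjacency conditions make \<open>(A - S) \<union> T\<close> and
  \<open>(B - T) \<union> S\<close> cliques of size \<open>v\<close>. By \<open>exchange\<close>
  both are old blocks, so nothing can have moved except nothing at all or the two blocks
  entirely.\<close>

lemma swap_between_blocks:
  assumes "A \<in> P" "B \<in> P" "A \<noteq> B" "S \<subseteq> A" "T \<subseteq> B" "card S = card T"
    and AT: "\<And>x y. x \<in> A - S \<Longrightarrow> y \<in> T \<Longrightarrow> {x, y} \<in> E"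
    and SB: "\<And>x y. x \<in> S \<Longrightarrow> y \<in> B - T \<Longrightarrow> {x, y} \<in> E"
  shows "T = {} \<or> T = B"
proof -
  let ?A = "(A - S) \<union> T" and ?B = "(B - T) \<union> S"
  have AB: "A \<inter> B = {}" using assms(1-3) block_eqI by blast
  have fin: "finite A" "finite B" "finite S" "finite T"
    using assms finite_block finite_subset by metis+
  have "card ?A = card A - card S + card T" "card ?B = card B - card T + card S"
    using fin AB assms(4,5) by (subst card_Un_disjoint; auto simp: card_Diff_subset)+
  moreover have "card S \<le> card A" "card T \<le> card B"
    using fin assms(4,5) by (simp_all add: card_mono)
  ultimately have card: "card ?A = v" "card ?B = v"
    using assms(1,2,6) card_block by auto
  have disj: "?A \<inter> ?B = {}" using AB assms(4,5) by auto
  have ne: "?A \<noteq> {}" "?B \<noteq> {}" using card v_ge_2 by fastforce+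
  have "{?A, ?B} \<subseteq> P"
  proof (rule exchange)
    show "{A, B} \<subseteq> P" using assms by simp
    have "\<Union>{?A, ?B} = \<Union>{A, B}" using assms(4,5) by auto
    moreover have "disjoint {?A, ?B}"
      using disj by (simp add: pairwise_insert disjnt_def Int_commute)
    moreover have "{} \<notin> {?A, ?B}" using ne by simp
    ultimately show "partition_on (\<Union>{A, B}) {?A, ?B}" by (simp add: partition_on_def)
    have "?A \<noteq> ?B" using disj ne by (metis Int_absorb)
    then show "card {?A, ?B} = card {A, B}" using assms(3) by simp
    have sub: "clique X E" if "X \<subseteq> A \<or> X \<subseteq> B" for X
      using that assms(1,2) block_adjacent by (auto simp: clique_def)
    have "clique ?A E" using AT assms(5) by (intro clique_Un sub) auto
    moreover have "clique (S \<union> (B - T)) E"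
      using SB assms(4) by (intro clique_Un sub) auto
    ultimately show "card C = v \<and> clique C E" if "C \<in> {?A, ?B}" for C
      using that card by (auto simp: Un_commute)
  qed
  then have A': "?A \<in> P" by simp
  show ?thesis
  proof (cases "T = {}")
    case False
    \<comment> \<open>As \<open>T\<close> is nonempty, the new block meets \<open>B\<close> and so
      equals \<open>B\<close>. No vertex of \<open>A\<close> can then have stayed behind.\<close>
    then have "?A = B" using A' assms(2,5) block_eqI by blast
    then have "S = A" using AB assms(4) by blast
    then have "card T = card B" using assms card_block by simp
    then show ?thesis using fin assms(5) card_subset_eq by blast
  qed simp
qed

text \<open>Here \<open>b\<close> moves into \<open>A\<close>, \<open>c\<close> into
  \<open>B\<close> and \<open>a\<close> into \<open>C\<close>, each being joined to all that remains
  there. The new block containing \<open>b\<close> would have to be \<open>B\<close>, yet it retains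
  a vertex of \<open>A\<close> because \<open>v \<ge> 2\<close>.\<close>

lemma no_rotation:
  assumes "A \<in> P" "B \<in> P" "C \<in> P" "A \<noteq> B" "B \<noteq> C" "A \<noteq> C"
    and "a \<in> A" "b \<in> B" "c \<in> C"
    and bA: "\<And>x. x \<in> A - {a} \<Longrightarrow> {b, x} \<in> E"
    and cB: "\<And>x. x \<in> B - {b} \<Longrightarrow> {c, x} \<in> E"
    and aC: "\<And>x. x \<in> C - {c} \<Longrightarrow> {a, x} \<in> E"
  shows False
proof -
  let ?A = "insert b (A - {a})" and ?B = "insert c (B - {b})" and ?C = "insert a (C - {c})"
  have disj: "A \<inter> B = {}" "B \<inter> C = {}" "A \<inter> C = {}"
    using assms(1-6) block_eqI by blast+
  have new: "card (insert y (X - {x})) = v \<and> clique (insert y (X - {x})) E"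
    if "X \<in> P" "x \<in> X" "y \<notin> X" "\<And>z. z \<in> X - {x} \<Longrightarrow> {y, z} \<in> E" for X x y
  proof
    show "card (insert y (X - {x})) = v"
      using that card_block[OF that(1)] finite_block[OF that(1)] v_ge_2
      by (simp add: card_Diff_singleton)
    show "clique (insert y (X - {x})) E"
      using that block_adjacent[OF that(1)] by (auto simp: clique_def insert_commute)
  qed
  have notin: "b \<notin> A" "c \<notin> B" "a \<notin> C" using disj assms(7-9) by blast+
  have distinct: "?A \<noteq> ?B" "?B \<noteq> ?C" "?A \<noteq> ?C"
    using other_element[OF assms(1), of a] other_element[OF assms(2), of b] disj assms(7-9)
    by (metis Diff_iff disjoint_iff insert_iff singletonD)+
  have "{?A, ?B, ?C} \<subseteq> P"
  proof (rule exchange)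
    show "{A, B, C} \<subseteq> P" using assms by simp
    show "partition_on (\<Union>{A, B, C}) {?A, ?B, ?C}"
      using disj assms(7-9) by (auto simp: partition_on_def disjoint_def)
    show "card {?A, ?B, ?C} = card {A, B, C}"
      using distinct assms(4-6) by simp
    show "card D = v \<and> clique D E" if "D \<in> {?A, ?B, ?C}" for D
      using that new[OF assms(1,7) notin(1) bA] new[OF assms(2,8) notin(2) cB]
        new[OF assms(3,9) notin(3) aC] by auto
  qed
  then have "?A = B" using assms(2,8) block_eqI by blast
  moreover obtain x where "x \<in> A" "x \<noteq> a" using other_element[OF assms(1)] .
  ultimately show False using disj by blast
qed

section \<open>Missing edges between two blocks\<close>

definition missing :: "'a set \<Rightarrow> 'a set \<Rightarrow> ('a \<times> 'a) set" where
  "missing A B = {(a, b) \<in> A \<times> B. {a, b} \<notin> E}"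

text \<open>The non-edges between \<open>A\<close> and \<open>B\<close> form a star with centre
  \<open>a\<close> whose leaves are all of \<open>B\<close>. In the target graph
  \<open>(i, 0)\<close> plays this role for row \<open>i\<close> towards every later row.\<close>

definition apex :: "'a set \<Rightarrow> 'a \<Rightarrow> 'a set \<Rightarrow> bool" where
  "apex A a B \<longleftrightarrow> a \<in> A \<and> (\<forall>x\<in>A. \<forall>y\<in>B. {x, y} \<in> E \<longleftrightarrow> x \<noteq> a)"

lemma finite_missing: "A \<in> P \<Longrightarrow> B \<in> P \<Longrightarrow> finite (missing A B)"
  by (rule finite_subset[of _ "A \<times> B"]) (auto simp: missing_def finite_block)

lemma card_missing_commute: "card (missing A B) = card (missing B A)"
proof -
  have "missing B A = prod.swap ` missing A B"
    by (auto simp: missing_def insert_commute)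
  then show ?thesis by (simp add: card_image)
qed

lemma missing_cover:
  assumes "A \<in> P" "B \<in> P" "A \<noteq> B" and cover: "\<And>b. b \<in> B \<Longrightarrow> \<exists>a\<in>A. {a, b} \<notin> E"
  shows "v \<le> card (missing A B)" and "card (missing A B) = v \<Longrightarrow> \<exists>a. apex A a B"
proof -
  obtain \<phi> where \<phi>: "\<And>b. b \<in> B \<Longrightarrow> \<phi> b \<in> A \<and> {\<phi> b, b} \<notin> E"
    using cover by metis
  \<comment> \<open>The graph of \<open>\<phi>\<close> consists of \<open>v\<close> missing pairs,
    which gives the bound. In the case of equality there are no others, so \<open>\<phi> y\<close>
    is the only vertex of \<open>A\<close> not joined to \<open>y\<close>.\<close>
  let ?M = "(\<lambda>b. (\<phi> b, b)) ` B"
  have cardM: "card ?M = v"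
    using card_block[OF assms(2)] by (subst card_image) (auto simp: inj_on_def)
  have sub: "?M \<subseteq> missing A B" using \<phi> by (auto simp: missing_def)
  show "v \<le> card (missing A B)"
    using card_mono[OF finite_missing sub] assms cardM by simp
  assume "card (missing A B) = v"
  then have "?M = missing A B"
    using card_subset_eq[OF finite_missing sub] assms cardM by simp
  then have adj: "{x, y} \<in> E \<longleftrightarrow> x \<noteq> \<phi> y" if "x \<in> A" "y \<in> B" for x y
    using that by (auto simp: missing_def set_eq_iff)
  obtain b where b: "b \<in> B" using other_element[OF assms(2)] .
  define T where "T = {y \<in> B. \<phi> y = \<phi> b}"
  have T: "T \<subseteq> B" "b \<in> T" using b by (auto simp: T_def)
  have fin: "finite A" "finite B" "finite T"
    using assms finite_block T finite_subset by metis+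
  \<comment> \<open>The fibre \<open>T\<close> contributes one value of \<open>\<phi>\<close> and
    each vertex outside it at most one more. Hence at least \<open>card T - 1\<close> vertices of
    \<open>A\<close> lie outside the range, enough to complete \<open>\<phi> b\<close> to a set of
    size \<open>card T\<close>.\<close>
  have "\<phi> ` B = insert (\<phi> b) (\<phi> ` (B - T))" using b by (auto simp: T_def)
  then have "card (\<phi> ` B) \<le> Suc (card (\<phi> ` (B - T)))"
    using fin by (simp add: card_insert_if)
  also have "\<dots> \<le> Suc (card (B - T))" using fin by (simp add: card_image_le)
  also have "card (B - T) = v - card T"
    using T fin card_block[OF assms(2)] by (simp add: card_Diff_subset)
  finally have le: "card (\<phi> ` B) \<le> Suc (v - card T)" .
  have T1: "1 \<le> card T" "card T \<le> v"
    using T fin card_block[OF assms(2)] card_mono[OF fin(2) T(1)]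
    by (auto simp: Suc_le_eq card_gt_0_iff)
  have "card (A - \<phi> ` B) = v - card (\<phi> ` B)"
    using \<phi> fin card_block[OF assms(1)] by (subst card_Diff_subset) auto
  then have "card T - 1 \<le> card (A - \<phi> ` B)" using le T1 by linarith
  then obtain S where S: "S \<subseteq> A - \<phi> ` B" "card S = card T - 1" "finite S"
    using obtain_subset_with_card_n by metis
  \<comment> \<open>The vertices of \<open>S\<close> are joined to all of \<open>B\<close>, and
    \<open>\<phi> b\<close> to all of \<open>B - T\<close>. The vertices of \<open>T\<close> miss
    only \<open>\<phi> b\<close>, which leaves \<open>A\<close>.\<close>
  have "T = {} \<or> T = B"
  proof (rule swap_between_blocks[OF assms(1-3)])
    show "insert (\<phi> b) S \<subseteq> A" using S b \<phi> by auto
    show "T \<subseteq> B" by fact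
    have "\<phi> b \<notin> S" using S b by auto
    then show "card (insert (\<phi> b) S) = card T" using S T1 by simp
    show "{x, y} \<in> E" if "x \<in> A - insert (\<phi> b) S" "y \<in> T" for x y
      using that adj T by (auto simp: T_def)
    show "{x, y} \<in> E" if "x \<in> insert (\<phi> b) S" "y \<in> B - T" for x y
      using that adj S b \<phi> by (auto simp: T_def)
  qed
  then have "T = B" using T by blast
  then have "\<phi> y = \<phi> b" if "y \<in> B" for y using that unfolding T_def by blast
  then have "\<forall>x\<in>A. \<forall>y\<in>B. {x, y} \<in> E \<longleftrightarrow> x \<noteq> \<phi> b" using adj by metis
  then have "apex A (\<phi> b) B" unfolding apex_def using b \<phi> by blast
  then show "\<exists>a. apex A a B" ..
qed

text \<open>Two vertices violating this could be swapped as singletons, forcing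
  \<open>{b} = B\<close> against \<open>v \<ge> 2\<close>. The two alternatives are the hypothesis
  of \<open>missing_cover\<close> for \<open>A\<close>, \<open>B\<close> and for \<open>B\<close>,
  \<open>A\<close>.\<close>

lemma no_two_full_vertices:
  assumes "A \<in> P" "B \<in> P" "A \<noteq> B"
  shows "(\<forall>b\<in>B. \<exists>a\<in>A. {a, b} \<notin> E) \<or> (\<forall>a\<in>A. \<exists>b\<in>B. {b, a} \<notin> E)"
proof (rule ccontr)
  assume "\<not> ?thesis"
  then obtain a b where ab: "b \<in> B" "\<And>x. x \<in> A \<Longrightarrow> {x, b} \<in> E"
      "a \<in> A" "\<And>y. y \<in> B \<Longrightarrow> {y, a} \<in> E" by blast
  have "{b} = {} \<or> {b} = B"
    by (rule swap_between_blocks[OF assms, of "{a}"]) (use ab in \<open>auto simp: insert_commute\<close>)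
  then show False using card_block[OF assms(2)] v_ge_2 by auto
qed

lemma card_missing_ge:
  assumes "A \<in> P" "B \<in> P" "A \<noteq> B"
  shows "v \<le> card (missing A B)"
  using no_two_full_vertices[OF assms] missing_cover(1)[of A B] missing_cover(1)[of B A] assms
  by (metis card_missing_commute)

lemma apex_cases:
  assumes "A \<in> P" "B \<in> P" "A \<noteq> B" "card (missing A B) = v"
  shows "(\<exists>a. apex A a B) \<or> (\<exists>b. apex B b A)"
  using no_two_full_vertices[OF assms(1-3)] missing_cover(2)[of A B] missing_cover(2)[of B A] assms
  by (metis card_missing_commute)

section \<open>Counting the missing edges\<close>

lemma card_missing_sum:
  "(\<Sum>(A, B)\<in>{(A, B). A \<in> P \<and> B \<in> P \<and> A \<noteq> B}. card (missing A B)) + 2 * card E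
    = card V * (card V - 1)"
proof -
  let ?I = "{(A, B). A \<in> P \<and> B \<in> P \<and> A \<noteq> B}"
  \<comment> \<open>All ordered pairs of distinct vertices are counted. Blocks are cliques, so a
    nonadjacent pair lies across two blocks and belongs to \<open>?N\<close>; the set
    \<open>?D\<close> holds both orientations of every edge.\<close>
  let ?N = "\<Union>(A, B)\<in>?I. missing A B" and ?D = "\<Union>e\<in>E. {(x, y). {x, y} = e}"
  have finI: "finite ?I" by (rule finite_subset[of _ "P \<times> P"]) (use finite_P in auto)
  have EV: "E \<subseteq> Pow V" "\<And>e. e \<in> E \<Longrightarrow> card e = 2"
    using graph by (auto simp: simple_graph_def nsets_def)
  then have finE: "finite E" using finite_V finite_subset by blast
  have D2: "finite {(x, y). {x, y} = e} \<and> card {(x, y). {x, y} = e} = 2" if e: "e \<in> E" for e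
  proof -
    obtain x y where "e = {x, y}" "x \<noteq> y" using EV(2)[OF e] by (auto simp: card_2_iff)
    moreover from this have "{(x, y). {x, y} = e} = {(x, y), (y, x)}"
      by (auto simp: doubleton_eq_iff)
    ultimately show ?thesis by simp
  qed
  have "card ?N = (\<Sum>p\<in>?I. card (case p of (A, B) \<Rightarrow> missing A B))"
  proof (rule card_UN_disjoint[OF finI])
    show "\<forall>p\<in>?I. finite (case p of (A, B) \<Rightarrow> missing A B)" using finite_missing by auto
    show "\<forall>p\<in>?I. \<forall>q\<in>?I. p \<noteq> q \<longrightarrow>
        (case p of (A, B) \<Rightarrow> missing A B) \<inter> (case q of (A, B) \<Rightarrow> missing A B) = {}"
      using block_eqI by (fastforce simp: missing_def)
  qed
  then have cardN: "card ?N = (\<Sum>(A, B)\<in>?I. card (missing A B))"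
    by (simp add: case_prod_unfold)
  have "card ?D = (\<Sum>e\<in>E. card {(x, y). {x, y} = e})"
    using D2 finE by (intro card_UN_disjoint) auto
  then have cardD: "card ?D = 2 * card E" using D2 by simp
  have "?N \<union> ?D = V \<times> V - (\<lambda>x. (x, x)) ` V"
  proof (intro equalityI subsetI)
    fix p assume p: "p \<in> ?N \<union> ?D"
    obtain x y where xy: "p = (x, y)" by fastforce
    from p have "x \<in> V \<and> y \<in> V \<and> x \<noteq> y"
    proof
      assume "p \<in> ?N"
      then obtain A B where "A \<in> P" "B \<in> P" "A \<noteq> B" "x \<in> A" "y \<in> B"
        unfolding xy by (auto simp: missing_def)
      then show ?thesis using block_subset block_eqI by blast
    next
      assume "p \<in> ?D"
      then have "{x, y} \<in> E" unfolding xy by auto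
      then show ?thesis using EV(1) not_loop by force
    qed
    then show "p \<in> V \<times> V - (\<lambda>x. (x, x)) ` V" using xy by auto
  next
    fix p assume p: "p \<in> V \<times> V - (\<lambda>x. (x, x)) ` V"
    then obtain x y where xy: "p = (x, y)" "x \<in> V" "y \<in> V" "x \<noteq> y" by auto
    obtain A B where AB: "A \<in> P" "B \<in> P" "x \<in> A" "y \<in> B"
      using xy partition by (auto simp: partition_on_def)
    show "p \<in> ?N \<union> ?D"
    proof (cases "{x, y} \<in> E")
      case True
      then show ?thesis using xy by blast
    next
      case False
      then have "A \<noteq> B" using AB xy(4) block_adjacent by blast
      then have "(A, B) \<in> ?I" "p \<in> missing A B"
        using False xy AB by (simp_all add: missing_def)
      then show ?thesis by blast
    qed
  qed
  moreover have "card (V \<times> V - (\<lambda>x. (x, x)) ` V) = card V * card V - card V"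
    using finite_V
    by (subst card_Diff_subset) (auto simp: card_image inj_on_def card_cartesian_product)
  moreover have "card (?N \<union> ?D) = card ?N + card ?D"
    using finI finE D2 finite_missing by (intro card_Un_disjoint) (auto simp: missing_def)
  ultimately have "card ?N + card ?D = card V * card V - card V" by simp
  then show ?thesis by (simp only: cardN cardD diff_mult_distrib2 mult_1_right)
qed

end

section \<open>Equality for every pair of blocks in the maximal case\<close>

locale maximal_clique_partition = unique_clique_partition +
  assumes card_E: "card E = ((n * v) choose 2) - n * (n - 1) * v div 2"
begin

text \<open>The edge count makes the total over the \<open>n * (n - 1)\<close> ordered pairs of
  blocks equal to \<open>n * (n - 1) * v\<close>. Each term is at least \<open>v\<close>, so none
  can exceed it.\<close>

lemma card_missing:
  assumes "A \<in> P" "B \<in> P" "A \<noteq> B"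
  shows "card (missing A B) = v"
proof -
  let ?I = "{(A, B). A \<in> P \<and> B \<in> P \<and> A \<noteq> B}"
  have finI: "finite ?I" by (rule finite_subset[of _ "P \<times> P"]) (use finite_P in auto)
  have "?I = P \<times> P - (\<lambda>A. (A, A)) ` P" by auto
  then have "card ?I = card (P \<times> P) - card ((\<lambda>A. (A, A)) ` P)"
    using finite_P by (simp add: card_Diff_subset image_subset_iff)
  then have cardI: "card ?I = n * (n - 1)"
    using card_P by (simp add: card_image inj_on_def card_cartesian_product diff_mult_distrib2)
  have cardV: "card V = n * v"
    using product_partition[OF partition] card_block finite_block card_P by simp
  have sum: "(\<Sum>(A, B)\<in>?I. card (missing A B)) + 2 * card E = n * v * (n * v - 1)"
    using card_missing_sum cardV by simp
  have "(\<Sum>(A, B)\<in>?I. v) \<le> (\<Sum>(A, B)\<in>?I. card (missing A B))"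
    using card_missing_ge by (intro sum_mono) auto
  then have lower: "n * (n - 1) * v \<le> (\<Sum>(A, B)\<in>?I. card (missing A B))"
    using cardI by (simp add: case_prod_unfold)
  have even: "even (k * (k - 1))" for k :: nat by (cases k) auto
  have "2 * ((n * v) choose 2) = n * v * (n * v - 1)"
    unfolding choose_two by (rule dvd_mult_div_cancel[OF even])
  moreover have "2 * (n * (n - 1) * v div 2) = n * (n - 1) * v"
    by (rule dvd_mult_div_cancel) (rule dvd_mult2[OF even])
  ultimately have "2 * card E = n * v * (n * v - 1) - n * (n - 1) * v"
    using card_E by (simp add: diff_mult_distrib2)
  \<comment> \<open>By \<open>lower\<close> and \<open>sum\<close>, the subtrahend is at most
    \<open>n * v * (n * v - 1)\<close>, so the subtraction does not truncate.\<close>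
  then have "(\<Sum>(A, B)\<in>?I. card (missing A B)) = n * (n - 1) * v"
    using sum lower by linarith
  then have "(\<Sum>p\<in>?I. v) = (\<Sum>p\<in>?I. card (missing (fst p) (snd p)))"
    using cardI by (simp add: case_prod_unfold)
  from sum_mono_inv[OF this _ _ finI, of "(A, B)"] show ?thesis
    using card_missing_ge assms by auto
qed

section \<open>The tournament on the blocks\<close>

definition dominates :: "'a set \<Rightarrow> 'a set \<Rightarrow> bool" where
  "dominates A B \<longleftrightarrow> A \<noteq> B \<and> (\<exists>a. apex A a B)"

lemma dominates_total:
  "A \<in> P \<Longrightarrow> B \<in> P \<Longrightarrow> A \<noteq> B \<Longrightarrow> dominates A B \<or> dominates B A"
  using apex_cases card_missing by (metis dominates_def)

text \<open>A vertex of \<open>B\<close> other than the apex \<open>b\<close> would be joined to all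
  of \<open>A\<close>, yet miss the apex \<open>a\<close>.\<close>

lemma dominates_asym:
  assumes "A \<in> P" "B \<in> P" "dominates A B" "dominates B A"
  shows False
proof -
  obtain a b where ab: "apex A a B" "apex B b A"
    using assms(3,4) by (auto simp: dominates_def)
  obtain y where "y \<in> B" "y \<noteq> b" using other_element[OF assms(2)] .
  then have "{y, a} \<in> E" "{a, y} \<notin> E" using ab by (simp_all add: apex_def)
  then show False by (simp add: insert_commute)
qed

text \<open>Otherwise the three blocks form a cyclic triangle. Each apex can then move into the
  block dominating its own: it is joined to everything there except the apex, which moves away as
  well.\<close>

lemma dominates_trans:
  assumes "A \<in> P" "B \<in> P" "C \<in> P" "dominates A B" "dominates B C"
  shows "dominates A C"
proof (rule ccontr)
  assume "\<not> dominates A C"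
  moreover have "A \<noteq> C" using assms dominates_asym by blast
  ultimately have "dominates C A" using dominates_total assms by blast
  then obtain a b c where abc: "apex A a B" "apex B b C" "apex C c A"
    using assms(4,5) by (auto simp: dominates_def)
  have distinct: "A \<noteq> B" "B \<noteq> C" using assms(4,5) by (auto simp: dominates_def)
  show False
  proof (rule no_rotation[OF assms(1-3) distinct \<open>A \<noteq> C\<close>, of a b c])
    show "a \<in> A" "b \<in> B" "c \<in> C" using abc by (auto simp: apex_def)
    show "{b, x} \<in> E" if "x \<in> A - {a}" for x
      using that abc by (auto simp: apex_def insert_commute)
    show "{c, x} \<in> E" if "x \<in> B - {b}" for x
      using that abc by (auto simp: apex_def insert_commute)
    show "{a, x} \<in> E" if "x \<in> C - {c}" for x
      using that abc by (auto simp: apex_def insert_commute)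
  qed
qed

lemma apex_unique:
  assumes "A \<in> P" "B \<in> P" "C \<in> P" "A \<noteq> B" "A \<noteq> C" "apex A a B" "apex A a' C"
  shows "a = a'"
proof -
  \<comment> \<open>By totality one of \<open>B\<close> and \<open>C\<close> dominates the other;
    the claim is generalised so that it also applies with their roles exchanged.\<close>
  have *: "a = a'"
    if B: "B \<in> P" "A \<noteq> B" "apex A a B" and C: "C \<in> P" "A \<noteq> C" "apex A a' C"
      and BC: "dominates B C" for B C a a'
  proof (rule ccontr)
    assume "a \<noteq> a'"
    obtain b where b: "apex B b C" "B \<noteq> C"
      using BC by (auto simp: dominates_def)
    obtain c where c: "c \<in> C" using other_element[OF C(1)] .
    show False
    \<comment> \<open>Any \<open>c\<close> will do: it is joined to \<open>B\<close> except for
      \<open>b\<close>. If \<open>a\<close> differs from \<open>a'\<close>, it is joined to all of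
      \<open>C\<close>, so it can take the place of \<open>c\<close>.\<close>
    proof (rule no_rotation[OF assms(1) B(1) C(1) B(2) b(2) C(2), of a b c])
      show "a \<in> A" "b \<in> B" "c \<in> C"
        using B(3) b(1) c by (simp_all add: apex_def)
      show "{b, x} \<in> E" if "x \<in> A - {a}" for x
        using that B(3) b(1) by (simp add: apex_def insert_commute[of b])
      show "{c, x} \<in> E" if "x \<in> B - {b}" for x
        using that b(1) c by (simp add: apex_def insert_commute[of c])
      show "{a, x} \<in> E" if "x \<in> C - {c}" for x
        using that B(3) C(3) \<open>a \<noteq> a'\<close> by (simp add: apex_def)
    qed
  qed
  show ?thesis
  proof (cases "B = C")
    case True
    then obtain y where "y \<in> B" "y \<in> C" using other_element[OF assms(2)] by blast
    then show ?thesis using assms(6,7) by (metis apex_def)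
  next
    case False
    then consider "dominates B C" | "dominates C B" using dominates_total assms by blast
    then show ?thesis using * assms by metis
  qed
qed

section \<open>Coordinates of the vertices and the isomorphism\<close>

definition rank :: "'a set \<Rightarrow> nat" where
  "rank A = card {B \<in> P. dominates B A}"

lemma rank_less:
  assumes "A \<in> P" "B \<in> P" "dominates A B"
  shows "rank A < rank B"
  unfolding rank_def
proof (rule psubset_card_mono)
  show "finite {C \<in> P. dominates C B}" using finite_P by simp
  have "A \<notin> {C \<in> P. dominates C A}" by (simp add: dominates_def)
  moreover have "{C \<in> P. dominates C A} \<subseteq> {C \<in> P. dominates C B}"
    using dominates_trans assms by blast
  ultimately show "{C \<in> P. dominates C A} \<subset> {C \<in> P. dominates C B}"
    using assms by blast
qed

text \<open>Totality separates the ranks of distinct blocks, and no block dominates itself, so ranks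
  stay below \<open>n\<close>. An injection between sets of size \<open>n\<close> is onto.\<close>

lemma rank_bij: "bij_betw rank P {0..<n}"
proof -
  have inj: "inj_on rank P"
    by (rule inj_onI) (metis dominates_total rank_less less_irrefl)
  have "rank A < n" if "A \<in> P" for A
    unfolding rank_def card_P[symmetric]
    using that finite_P by (intro psubset_card_mono) (auto simp: dominates_def)
  then have "rank ` P \<subseteq> {0..<n}" by auto
  then have "rank ` P = {0..<n}"
    using card_image[OF inj] card_P by (intro card_subset_eq) auto
  then show ?thesis using inj by (simp add: bij_betw_def)
qed

text \<open>By \<open>apex_unique\<close> one vertex of \<open>A\<close> is the apex towards all
  blocks that \<open>A\<close> dominates; it receives the number 0.\<close>

lemma numbering:
  assumes "A \<in> P"
  obtains g where "bij_betw g A {0..<v}"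
    "\<And>B x y. B \<in> P \<Longrightarrow> dominates A B \<Longrightarrow> x \<in> A \<Longrightarrow> y \<in> B \<Longrightarrow> {x, y} \<in> E \<longleftrightarrow> g x \<noteq> (0::nat)"
proof -
  obtain a where a: "a \<in> A" "\<And>B. B \<in> P \<Longrightarrow> dominates A B \<Longrightarrow> apex A a B"
  proof (cases "\<exists>B\<in>P. dominates A B")
    case True
    then obtain B a where B: "B \<in> P" "A \<noteq> B" "apex A a B"
      unfolding dominates_def by blast
    have "apex A a C" if C: "C \<in> P" "dominates A C" for C
    proof -
      obtain a' where "A \<noteq> C" "apex A a' C" using C(2) unfolding dominates_def by blast
      then show ?thesis using apex_unique[OF assms B(1) C(1) B(2) _ B(3)] by blast
    qed
    moreover have "a \<in> A" using B(3) by (simp add: apex_def)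
    ultimately show ?thesis using that by blast
  next
    \<comment> \<open>A block dominating no other has no apex, and any of its vertices may receive
      0.\<close>
    case False
    moreover obtain x where "x \<in> A" using other_element[OF assms] .
    ultimately show ?thesis using that by blast
  qed
  obtain h where h: "bij_betw h A {0..<v}"
    using ex_bij_betw_finite_nat[OF finite_block[OF assms]] card_block[OF assms] by auto
  define g where "g = transpose (h a) 0 \<circ> h"
  have "h a \<in> {0..<v}" using h a(1) by (auto simp: bij_betw_def)
  then have g: "bij_betw g A {0..<v}"
    unfolding g_def using v_ge_2
    by (intro bij_betw_trans[OF h] bij_betw_imageI) simp_all
  have "g a = 0" by (simp add: g_def)
  then have "g x = 0 \<longleftrightarrow> x = a" if "x \<in> A" for x
    using g a(1) that by (metis bij_betw_def inj_on_def)
  then show thesis using that[OF g] a by (auto simp: apex_def)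
qed

lemma isomorphic_Gamma': "graph_isomorphic V E (Gamma'_verts n v) (Gamma'_edges n v)"
proof -
  obtain g where g: "\<And>A. A \<in> P \<Longrightarrow> bij_betw (g A) A {0..<v}"
    "\<And>A B x y. A \<in> P \<Longrightarrow> B \<in> P \<Longrightarrow> dominates A B \<Longrightarrow> x \<in> A \<Longrightarrow> y \<in> B \<Longrightarrow>
      {x, y} \<in> E \<longleftrightarrow> g A x \<noteq> (0::nat)"
  proof -
    have "\<exists>g. bij_betw g A {0..<v} \<and> (\<forall>B x y. B \<in> P \<longrightarrow> dominates A B \<longrightarrow> x \<in> A \<longrightarrow> y \<in> B \<longrightarrow>
        ({x, y} \<in> E \<longleftrightarrow> g x \<noteq> (0::nat)))" if "A \<in> P" for A
      by (rule numbering[OF that]) blast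
    then show thesis using that by metis
  qed
  have "\<exists>A. A \<in> P \<and> x \<in> A" if "x \<in> V" for x
    using that partition by (auto simp: partition_on_def)
  then obtain blk where blk: "\<And>x. x \<in> V \<Longrightarrow> blk x \<in> P \<and> x \<in> blk x" by metis
  have blk_eq: "blk x = A" if "A \<in> P" "x \<in> A" for x A
    using that blk block_eqI block_subset by (metis subsetD)
  \<comment> \<open>Dominating blocks have smaller rank, matching the removal of edges from
    \<open>(i, 0)\<close> to rows \<open>k\<close> with \<open>i < k\<close>.\<close>
  define f where "f x = (rank (blk x), g (blk x) x)" for x
  have rank_inj: "A = B" if "A \<in> P" "B \<in> P" "rank A = rank B" for A B
    using rank_bij that by (auto simp: bij_betw_def inj_on_def)
  have inj: "inj_on f V"
  proof (rule inj_onI)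
    fix x y assume xy: "x \<in> V" "y \<in> V" "f x = f y"
    then have "blk x = blk y" using rank_inj blk by (simp add: f_def)
    then show "x = y"
      using xy g(1)[of "blk x"] blk by (auto simp: f_def bij_betw_def inj_on_def)
  qed
  have f_in: "f x \<in> Gamma'_verts n v" if "x \<in> V" for x
    using that blk bij_betwE[OF rank_bij] bij_betwE[OF g(1)]
    by (fastforce simp: f_def Gamma'_verts_def)
  have "Gamma'_verts n v \<subseteq> f ` V"
  proof
    fix p assume "p \<in> Gamma'_verts n v"
    then obtain i j where ij: "p = (i, j)" "i \<in> {0..<n}" "j \<in> {0..<v}"
      by (auto simp: Gamma'_verts_def)
    obtain A where A: "A \<in> P" "rank A = i"
      using bij_betw_imp_surj_on[OF rank_bij] ij(2) by (metis imageE)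
    obtain x where x: "x \<in> A" "g A x = j"
      using bij_betw_imp_surj_on[OF g(1)[OF A(1)]] ij(3) by (metis imageE)
    have "f x = p" using x A ij(1) blk_eq by (simp add: f_def)
    then show "p \<in> f ` V" using x A block_subset by blast
  qed
  then have bij: "bij_betw f V (Gamma'_verts n v)"
    using inj f_in by (auto simp: bij_betw_def)
  have less: "{x, y} \<in> E \<longleftrightarrow> {f x, f y} \<in> Gamma'_edges n v"
    if "x \<in> V" "y \<in> V" "dominates (blk x) (blk y)" for x y
  proof -
    \<comment> \<open>Edges are unordered; the strict inequality decides that \<open>f x\<close>,
      not \<open>f y\<close>, must be the endpoint \<open>(i, 0)\<close> of a removed edge.\<close>
    have lt: "fst (f x) < fst (f y)"
      using rank_less blk that by (simp add: f_def)
    have "{f x, f y} \<in> Gamma'_edges n v \<longleftrightarrow>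
        \<not> (\<exists>i k l. {f x, f y} = {(i, 0), (k, l)} \<and> i < k \<and> k < n \<and> l < v)"
      using f_in that lt by (auto simp: Gamma'_edges_def)
    also have "(\<exists>i k l. {f x, f y} = {(i, 0), (k, l)} \<and> i < k \<and> k < n \<and> l < v)
        \<longleftrightarrow> snd (f x) = 0"
    proof
      assume "\<exists>i k l. {f x, f y} = {(i, 0), (k, l)} \<and> i < k \<and> k < n \<and> l < v"
      then show "snd (f x) = 0" using lt by (auto simp: doubleton_eq_iff)
    next
      assume "snd (f x) = 0"
      then have "{f x, f y} = {(fst (f x), 0), (fst (f y), snd (f y))}"
        by (metis prod.collapse)
      moreover have "fst (f y) < n" "snd (f y) < v"
        using f_in[OF that(2)] by (auto simp: Gamma'_verts_def)
      ultimately show "\<exists>i k l. {f x, f y} = {(i, 0), (k, l)} \<and> i < k \<and> k < n \<and> l < v"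
        using lt by blast
    qed
    finally show ?thesis
      using g(2)[of "blk x" "blk y" x y] blk that by (simp add: f_def)
  qed
  have "{x, y} \<in> E \<longleftrightarrow> {f x, f y} \<in> Gamma'_edges n v" if xy: "x \<in> V" "y \<in> V" for x y
  proof -
    consider "x = y" | "x \<noteq> y" "blk x = blk y" | "dominates (blk x) (blk y)"
      | "dominates (blk y) (blk x)"
      using dominates_total blk xy by metis
    then show ?thesis
    proof cases
      case 1
      then show ?thesis using not_loop by (auto simp: Gamma'_edges_def nsets_def)
    next
      case 2
      then have "{x, y} \<in> E" using block_adjacent blk xy by metis
      moreover have "f x \<noteq> f y" using inj xy 2 by (auto simp: inj_on_def)
      \<comment> \<open>Removed edges join different rows, so the edge within a row
        survives.\<close>
      moreover have "fst (f x) = fst (f y)" using 2 by (simp add: f_def)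
      ultimately show ?thesis
        using f_in xy by (auto simp: Gamma'_edges_def doubleton_eq_iff)
    next
      case 3
      then show ?thesis using less xy by blast
    next
      case 4
      then show ?thesis using less[of y x] xy by (simp add: insert_commute)
    qed
  qed
  then show ?thesis using bij by (auto simp: graph_isomorphic_def)
qed

end

theorem theorem3p6:
  fixes n v :: nat
    and V :: "'a set"
    and E :: "'a set set"
  assumes "n \<ge> 2"
    and "v \<ge> 2"
    and "maximal_weakly_clique_partitioned n v V E"
  shows "graph_isomorphic V E (Gamma'_verts n v) (Gamma'_edges n v)"
proof -
  have weak: "weakly_clique_partitioned n v V E"
    and card_E: "card E = ((n * v) choose 2) - n * (n - 1) * v div 2"
    using assms(3) by (simp_all add: maximal_weakly_clique_partitioned_def)
  obtain P where P: "clique_partition n v V E P"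
    and unique: "\<And>P'. clique_partition n v V E P' \<Longrightarrow> P' = P"
    using weak unfolding weakly_clique_partitioned_def by blast
  have "simple_graph V E" using weak by (simp add: weakly_clique_partitioned_def)
  then interpret maximal_clique_partition n v V E P
    using assms(2) P unique card_E by unfold_locales
  show ?thesis by (rule isomorphic_Gamma')
qed

end
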